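(* Let $\mathcal{L}$ and $\mathcal{M}$ be set systems and let $\mathfrak{O}:\mathcal{M}\to\mathcal{L}$ be a deformation (i.e. a monotone map: $M\subseteq M'$ implies $\mathfrak{O}(M)\subseteq\mathfrak{O}(M')$). If $\mathcal{M}$ is a better elastic set system, then so is the image $\mathfrak{O}[\mathcal{M}]=\{\mathfrak{O}(M): M\in\mathcal{M}\}$.
   Context: A set system over a set $T$ is a family $\mathcal{L}\subseteq P(T)$; $\bigcup\mathcal{L}$ denotes the union of its members. For a set system $\mathcal{L}$, $\mathrm{qo}(\mathcal{L})$ is the quasi-ordering $(\bigcup\mathcal{L},\preceq_{\mathcal{L}})$ where $x\preceq_{\mathcal{L}}y$ iff for every $L\in\mathcal{L}$, $x\in L$ implies $y\in L$. A set system $\mathcal{L}$ is a better elastic set system (BESS) if $\mathrm{qo}(\mathcal{L})$ is a better quasi-ordering (BQO). BQOs are defined via barriers: identify $\omega$ with the nonnegative integers and each finite $s\subseteq\omega$ with its strictly increasing enumeration. A barrier is a family $B$ of finite subsets of $\omega$ such that (1) $\bigcup B$ is infinite; (2) for every infinite $\sigma\subseteq\bigcup B$ there is $s\in B$ which is a prefix (initial segment) of the increasing enumeration of $\sigma$; (3) no member of $B$ is a proper subset of another. For finite $s,t\subseteq\omega$, write $s\triangleleft t$ if $s$ is a prefix of $u=s\cup t$ and $t$ is a prefix of $u\setminus\{\min u\}$. Let $\mathrm{o.t.}(B)$ be the order type of $B$ under the lexicographic ordering. For a quasi-ordering $(Q,\preceq)$, a map $f:B\to Q$ is good if there are $s,t\in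 B$ with $s\triangleleft t$ and $f(s)\preceq f(t)$, and bad otherwise. For a countable ordinal $\alpha$, $(Q,\preceq)$ is an $\alpha$-wqo if for every barrier $B$ with $\mathrm{o.t.}(B)\le\alpha$ every map $B\to Q$ is good; it is a BQO if it is an $\alpha$-wqo for every countable ordinal $\alpha$. *)

theory Defs
  imports Main "HOL-Library.FuncSet" "HOL-Library.Infinite_Set" "HOL-Library.Sublist"
begin

(* A finite set of naturals is identified with its strictly increasing enumeration,
   the list sorted_list_of_set s; an infinite one with the sequence enumerate \<sigma>. *)

definition prefix_inf :: "nat set \<Rightarrow> nat set \<Rightarrow> bool" where
  "prefix_inf s \<sigma> \<longleftrightarrow> (\<exists>n. sorted_list_of_set s = map (enumerate \<sigma>) [0..<n])"

definition prefix_fin :: "nat set \<Rightarrow> nat set \<Rightarrow> bool" where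
  "prefix_fin s u \<longleftrightarrow> prefix (sorted_list_of_set s) (sorted_list_of_set u)"

definition barrier :: "nat set set \<Rightarrow> bool" where
  "barrier B \<longleftrightarrow>
     (\<forall>s\<in>B. finite s) \<and>
     infinite (\<Union>B) \<and>
     (\<forall>\<sigma>. infinite \<sigma> \<and> \<sigma> \<subseteq> \<Union>B \<longrightarrow> (\<exists>s\<in>B. prefix_inf s \<sigma>)) \<and>
     (\<forall>s\<in>B. \<forall>t\<in>B. \<not> s \<subset> t)"

(* The value of Min on the empty set is irrelevant: if s \<union> t is empty then so is
   the set difference. *)
definition tri :: "nat set \<Rightarrow> nat set \<Rightarrow> bool" (infix "\<triangleleft>" 50) where
  "s \<triangleleft> t \<longleftrightarrow> prefix_fin s (s \<union> t) \<and> prefix_fin t ((s \<union> t) - {Min (s \<union> t)})"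

definition lex_on :: "nat set set \<Rightarrow> nat set rel" where
  "lex_on B = {(s, t). s \<in> B \<and> t \<in> B \<and>
     (s = t \<or> (sorted_list_of_set s, sorted_list_of_set t) \<in> lexord less_than)}"

definition good :: "'q rel \<Rightarrow> nat set set \<Rightarrow> (nat set \<Rightarrow> 'q) \<Rightarrow> bool" where
  "good r B f \<longleftrightarrow> (\<exists>s\<in>B. \<exists>t\<in>B. s \<triangleleft> t \<and> (f s, f t) \<in> r)"

(* A countable ordinal is represented by a well-order on a set of naturals (finite sets
   included); every countable ordinal is the order type of such a relation.  A barrier is
   well-ordered lexicographically, so membership in ordLeq, which demands that both
   relations be well-orders, says exactly that the order type of B is at most \<alpha>. *)
definition alpha_wqo :: "nat rel \<Rightarrow> 'q set \<Rightarrow> 'q rel \<Rightarrow> bool" where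
  "alpha_wqo \<alpha> Q r \<longleftrightarrow>
     preorder_on Q r \<and>
     (\<forall>B. barrier B \<and> (lex_on B, \<alpha>) \<in> ordLeq \<longrightarrow> (\<forall>f \<in> B \<rightarrow> Q. good r B f))"

definition bqo :: "'q set \<Rightarrow> 'q rel \<Rightarrow> bool" where
  "bqo Q r \<longleftrightarrow> (\<forall>\<alpha> :: nat rel. Well_order \<alpha> \<longrightarrow> alpha_wqo \<alpha> Q r)"

definition set_system :: "'a set \<Rightarrow> 'a set set \<Rightarrow> bool" where
  "set_system T \<L> \<longleftrightarrow> \<L> \<subseteq> Pow T"

definition qo :: "'a set set \<Rightarrow> 'a rel" where
  "qo \<L> = {(x, y). x \<in> \<Union>\<L> \<and> y \<in> \<Union>\<L> \<and> (\<forall>L\<in>\<L>. x \<in> L \<longrightarrow> y \<in> L)}"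

lemma preorder_on_qo: "preorder_on (\<Union>\<L>) (qo \<L>)"
  by (auto simp: preorder_on_def refl_on_def trans_def qo_def)

definition bess :: "'a set set \<Rightarrow> bool" where
  "bess \<L> \<longleftrightarrow> bqo (\<Union>\<L>) (qo \<L>)"

definition deformation :: "'a set set \<Rightarrow> 'b set set \<Rightarrow> ('a set \<Rightarrow> 'b set) \<Rightarrow> bool" where
  "deformation \<M> \<L> D \<longleftrightarrow> D \<in> \<M> \<rightarrow> \<L> \<and> mono_on \<M> D"

end

theory Submission
  imports Defs "HOL-Library.Nat_Bijection"
begin

text \<open>
  If \<open>f\<close> is a bad map from a barrier \<open>B\<close> into the image system, choose for all \<open>s \<triangleleft> t\<close> in \<open>B\<close>
  a member \<open>N s t\<close> of \<open>\<M>\<close> with \<open>f s \<in> D (N s t)\<close> and \<open>f t \<notin> D (N s t)\<close>. Whenever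
  \<open>s \<triangleleft> t \<triangleleft> r\<close>, the point \<open>f t\<close> lies in \<open>D (N t r)\<close> but not in \<open>D (N s t)\<close>, so monotonicity of
  \<open>D\<close> yields some \<open>g (s \<union> t \<union> r) \<in> N t r - N s t\<close>. The map \<open>g\<close> is defined on the barrier
  obtained by squaring \<open>B\<close> twice, and \<open>N t r\<close> witnesses that it is bad.
\<close>

section \<open>Initial segments of sets of naturals\<close>

definition iseg :: "nat set \<Rightarrow> nat set \<Rightarrow> bool" where
  "iseg s X \<longleftrightarrow> s \<subseteq> X \<and> (\<forall>x\<in>X. \<forall>y\<in>s. x < y \<longrightarrow> x \<in> s)"

lemma iseg_subset: "iseg s X \<Longrightarrow> s \<subseteq> X"
  by (simp add: iseg_def)

text \<open>If \<open>a\<close> lies only in \<open>s\<close> and \<open>b\<close> only in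
  \<open>t\<close>, the smaller of the two is forced into the other segment.\<close>

lemma iseg_comparable:
  assumes "iseg s X" "iseg t X"
  shows "s \<subseteq> t \<or> t \<subseteq> s"
proof (rule ccontr)
  assume "\<not> (s \<subseteq> t \<or> t \<subseteq> s)"
  then obtain a b where "a \<in> s" "a \<notin> t" "b \<in> t" "b \<notin> s"
    by blast
  with assms show False
    unfolding iseg_def by (cases a b rule: linorder_cases) auto
qed

text \<open>Together with \<open>prefix_inf_iff_iseg\<close> this turns prefixes of enumerations
  into a condition on sets, in one form for finite and infinite \<open>X\<close>.\<close>

lemma prefix_fin_iff_iseg:
  assumes "finite s" "finite u"
  shows "prefix_fin s u \<longleftrightarrow> iseg s u"
proof
  assume "prefix_fin s u"
  then obtain ys where ys: "sorted_list_of_set u = sorted_list_of_set s @ ys"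
    unfolding prefix_fin_def prefix_def by blast
  have "sorted_wrt (<) (sorted_list_of_set s @ ys)"
    using strict_sorted_list_of_set[of u] ys by simp
  then have less: "\<forall>x\<in>s. \<forall>y\<in>set ys. x < y"
    using assms by (simp add: sorted_wrt_append)
  have "u = s \<union> set ys"
    using assms ys by (metis set_append set_sorted_list_of_set)
  with less show "iseg s u"
    unfolding iseg_def by (auto dest: less_asym)
next
  assume seg: "iseg s u"
  have "sorted_wrt (<) (sorted_list_of_set s @ sorted_list_of_set (u - s))"
    using seg assms unfolding iseg_def
    by (auto simp: sorted_wrt_append) (metis linorder_neqE_nat subsetD)
  moreover have "set (sorted_list_of_set s @ sorted_list_of_set (u - s)) = u"
    using seg assms unfolding iseg_def by auto
  ultimately have "sorted_list_of_set u = sorted_list_of_set s @ sorted_list_of_set (u - s)"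
    by (metis assms(2) strict_sorted_equal strict_sorted_list_of_set set_sorted_list_of_set)
  then show "prefix_fin s u"
    unfolding prefix_fin_def by simp
qed

lemma iseg_enumerate_image:
  assumes "infinite \<sigma>"
  shows "iseg (enumerate \<sigma> ` {..<n}) \<sigma>"
  unfolding iseg_def
proof (intro conjI ballI impI)
  show "enumerate \<sigma> ` {..<n} \<subseteq> \<sigma>"
    using assms by (auto intro: enumerate_in_set)
next
  fix x y
  assume "x \<in> \<sigma>" "y \<in> enumerate \<sigma> ` {..<n}" "x < y"
  moreover obtain i where "x = enumerate \<sigma> i"
    using enumerate_Ex[OF assms \<open>x \<in> \<sigma>\<close>] by metis
  ultimately show "x \<in> enumerate \<sigma> ` {..<n}"
    using enumerate_mono_iff[OF assms] by auto
qed

lemma prefix_inf_iff_iseg: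
  assumes "finite s" "infinite \<sigma>"
  shows "prefix_inf s \<sigma> \<longleftrightarrow> iseg s \<sigma>"
proof
  assume "prefix_inf s \<sigma>"
  then obtain n where "sorted_list_of_set s = map (enumerate \<sigma>) [0..<n]"
    unfolding prefix_inf_def by blast
  then have "s = enumerate \<sigma> ` {..<n}"
    using assms(1) by (metis atLeast_upt list.set_map set_sorted_list_of_set)
  then show "iseg s \<sigma>"
    using iseg_enumerate_image[OF assms(2)] by simp
next
  assume seg: "iseg s \<sigma>"
  let ?e = "enumerate \<sigma> ` {..<card s}"
  have "inj_on (enumerate \<sigma>) {..<card s}"
    using assms(2) by (meson inj_enumerate inj_on_subset subset_UNIV)
  then have "card ?e = card s"
    by (simp add: card_image)
  \<comment> \<open>Of two nested finite sets with equally many elements neither is proper in the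
    other.\<close>
  with iseg_comparable[OF seg iseg_enumerate_image[OF assms(2)]] assms(1) have "s = ?e"
    by (metis card_subset_eq finite_imageI finite_lessThan)
  then have "set (map (enumerate \<sigma>) [0..<card s]) = s"
    by (simp add: atLeast_upt)
  moreover have "sorted_wrt (<) (map (enumerate \<sigma>) [0..<card s])"
    using enumerate_mono_iff[OF assms(2)] by (simp add: sorted_wrt_map)
  ultimately have "sorted_list_of_set s = map (enumerate \<sigma>) [0..<card s]"
    by (metis assms(1) strict_sorted_equal strict_sorted_list_of_set set_sorted_list_of_set)
  then show "prefix_inf s \<sigma>"
    unfolding prefix_inf_def by blast
qed

section \<open>Barriers in terms of initial segments\<close>

lemma barrier_finite: "barrier B \<Longrightarrow> s \<in> B \<Longrightarrow> finite s"
  by (simp add: barrier_def)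

lemma barrier_antichain: "barrier B \<Longrightarrow> s \<in> B \<Longrightarrow> t \<in> B \<Longrightarrow> s \<subseteq> t \<Longrightarrow> s = t"
  by (auto simp: barrier_def)

text \<open>The empty set is contained in every member, so the antichain condition would leave
  \<open>{{}}\<close>, whose union is finite.\<close>

lemma barrier_nonempty:
  assumes "barrier B" "s \<in> B"
  shows "s \<noteq> {}"
proof
  assume "s = {}"
  then have "B \<subseteq> {{}}"
    using barrier_antichain[OF assms] by blast
  then have "\<Union>B = {}"
    by blast
  then show False
    using assms(1) unfolding barrier_def by (metis finite.emptyI)
qed

lemma barrier_iseg:
  assumes "barrier B" "infinite \<sigma>" "\<sigma> \<subseteq> \<Union>B"
  obtains s where "s \<in> B" "iseg s \<sigma>"
  using assms by (metis barrier_def prefix_inf_iff_iseg)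

lemma barrier_iseg_unique:
  "barrier B \<Longrightarrow> s \<in> B \<Longrightarrow> t \<in> B \<Longrightarrow> iseg s X \<Longrightarrow> iseg t X \<Longrightarrow> s = t"
  by (metis barrier_antichain iseg_comparable)

lemma tri_iff_iseg:
  "finite s \<Longrightarrow> finite t \<Longrightarrow> s \<triangleleft> t \<longleftrightarrow> iseg s (s \<union> t) \<and> iseg t (s \<union> t - {Min (s \<union> t)})"
  by (simp add: tri_def prefix_fin_iff_iseg)

text \<open>In a barrier, \<open>t\<close> cannot stop before \<open>s\<close> does, as it would then be a proper subset of \<open>s\<close>.\<close>

lemma barrier_tri_minus_Min:
  assumes B: "barrier B" "s \<in> B" "t \<in> B" and "s \<triangleleft> t"
  shows "s \<union> t - {Min (s \<union> t)} = t"
proof -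
  let ?u = "s \<union> t"
  have fin: "finite s" "finite t"
    using B barrier_finite by auto
  then have seg: "iseg s ?u" "iseg t (?u - {Min ?u})"
    using assms by (auto simp: tri_iff_iseg)
  have ne: "s \<noteq> {}"
    using B barrier_nonempty by blast
  then have Min: "Min ?u \<in> ?u" "\<And>x. x \<in> ?u \<Longrightarrow> Min ?u \<le> x"
    using fin by (intro Min_in Min_le; blast)+
  then have Min_s: "Min ?u \<in> s"
    using ne seg(1) unfolding iseg_def by (metis all_not_in_conv UnCI le_neq_implies_less)
  have "iseg (s - {Min ?u}) (?u - {Min ?u})"
    using seg(1) unfolding iseg_def by auto
  with seg(2) have "s - {Min ?u} \<subseteq> t \<or> t \<subseteq> s - {Min ?u}"
    using iseg_comparable by blast
  moreover have "\<not> t \<subseteq> s - {Min ?u}"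
    using Min_s barrier_antichain[OF B(1) B(3) B(2)] by blast
  ultimately have "s - {Min ?u} \<subseteq> t"
    by satx
  with iseg_subset[OF seg(2)] show ?thesis
    by blast
qed

section \<open>The square of a barrier\<close>

definition square :: "nat set set \<Rightarrow> nat set set" where
  "square B = {s \<union> t | s t. s \<in> B \<and> t \<in> B \<and> s \<triangleleft> t}"

lemma squareE:
  assumes "u \<in> square B"
  obtains s t where "s \<in> B" "t \<in> B" "s \<triangleleft> t" "u = s \<union> t"
  using assms unfolding square_def by blast

lemma square_finite: "barrier B \<Longrightarrow> u \<in> square B \<Longrightarrow> finite u"
  by (elim squareE) (simp add: barrier_finite)

lemma square_nonempty: "barrier B \<Longrightarrow> u \<in> square B \<Longrightarrow> u \<noteq> {}"
  by (elim squareE) (simp add: barrier_nonempty)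

text \<open>For \<open>u = s \<union> t\<close> the set obtained is \<open>t\<close>. This reduces
  antichain and order questions about the square to \<open>B\<close>.\<close>

lemma square_minus_Min: "barrier B \<Longrightarrow> u \<in> square B \<Longrightarrow> u - {Min u} \<in> B"
  by (elim squareE) (simp only: barrier_tri_minus_Min)

text \<open>The union without its minimum is \<open>t\<close>, and \<open>s\<close> is the only
  member of \<open>B\<close> that is an initial segment of the union. Hence functions of pairs
  become functions on the square.\<close>

lemma barrier_union_unique:
  assumes B: "barrier B" "s \<in> B" "t \<in> B" "s' \<in> B" "t' \<in> B"
    and "s \<triangleleft> t" "s' \<triangleleft> t'" "s \<union> t = s' \<union> t'"
  shows "s = s'" "t = t'"
proof -
  show "t = t'"
    using barrier_tri_minus_Min[OF B(1-3)] barrier_tri_minus_Min[OF B(1,4,5)] assms(6-8) by simp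
  have "iseg s (s \<union> t)" "iseg s' (s \<union> t)"
    using assms by (simp_all add: tri_iff_iseg barrier_finite)
  then show "s = s'"
    using B barrier_iseg_unique by blast
qed

text \<open>The second component of \<open>u\<close> and the first component of \<open>v\<close> are
  both initial segments of \<open>u \<union> v\<close> without its minimum, hence equal.\<close>

lemma square_tri:
  assumes B: "barrier B" and "u \<in> square B" "v \<in> square B" "u \<triangleleft> v"
  obtains s t r where "s \<in> B" "t \<in> B" "r \<in> B" "s \<triangleleft> t" "t \<triangleleft> r" "u = s \<union> t" "v = t \<union> r"
proof -
  obtain s t where st: "s \<in> B" "t \<in> B" "s \<triangleleft> t" "u = s \<union> t"
    using assms(2) squareE by blast
  obtain t' r where tr: "t' \<in> B" "r \<in> B" "t' \<triangleleft> r" "v = t' \<union> r"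
    using assms(3) squareE by blast
  let ?x = "u \<union> v - {Min (u \<union> v)}"
  have fin: "finite u" "finite v" and ne: "u \<noteq> {}"
    using assms square_finite square_nonempty by auto
  then have seg: "iseg u (u \<union> v)" "iseg v ?x"
    using assms(4) by (simp_all add: tri_iff_iseg)
  have "Min (u \<union> v) \<in> u"
    using seg(1) ne fin Min_le[of "u \<union> v"] Min_in[of "u \<union> v"] unfolding iseg_def
    by (metis UnCI all_not_in_conv finite_UnI le_neq_implies_less)
  then have "Min (u \<union> v) = Min u"
    using fin by (metis Min_antimono Min_le finite_UnI ne order_antisym sup_ge1)
  \<comment> \<open>Since \<open>u\<close> starts at the minimum of \<open>u \<union> v\<close>,
    deleting that minimum from \<open>u\<close> leaves its second component.\<close>
  then have t: "u - {Min (u \<union> v)} = t"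
    using barrier_tri_minus_Min[OF B st(1-3)] st(4) by simp
  have "iseg (u - {Min (u \<union> v)}) ?x"
    using seg(1) unfolding iseg_def by auto
  then have "iseg t ?x"
    by (simp only: t)
  moreover have "iseg t' ?x"
  proof -
    have "iseg t' v"
      using tr B by (simp add: tri_iff_iseg barrier_finite)
    with seg(2) show ?thesis
      unfolding iseg_def by (meson subset_trans subsetD)
  qed
  ultimately have "t = t'"
    using barrier_iseg_unique[OF B st(2) tr(1)] by blast
  with st tr that show thesis
    by blast
qed

text \<open>The pair consists of the prefix of \<open>\<sigma>\<close> in \<open>B\<close> and the
  prefix in \<open>B\<close> of \<open>\<sigma>\<close> without its least element
  \<open>m\<close>.\<close>

lemma square_iseg:
  assumes B: "barrier B" and "infinite \<sigma>" "\<sigma> \<subseteq> \<Union>B"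
  obtains u where "u \<in> square B" "iseg u \<sigma>"
proof -
  define m where "m = (LEAST x. x \<in> \<sigma>)"
  have "\<sigma> \<noteq> {}"
    using assms(2) by auto
  then have m: "m \<in> \<sigma>" "\<And>x. x \<in> \<sigma> \<Longrightarrow> m \<le> x"
    unfolding m_def by (auto intro: LeastI Least_le)
  obtain s where s: "s \<in> B" "iseg s \<sigma>"
    using barrier_iseg[OF assms] .
  have "infinite (\<sigma> - {m})" "\<sigma> - {m} \<subseteq> \<Union>B"
    using assms by auto
  then obtain t where t: "t \<in> B" "iseg t (\<sigma> - {m})"
    using barrier_iseg[OF B] by blast
  have fin: "finite s" "finite t"
    using B s t barrier_finite by auto
  have ms: "m \<in> s"
    using barrier_nonempty[OF B s(1)] s(2) m unfolding iseg_def
    by (metis all_not_in_conv le_neq_implies_less subsetD)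
  have sub: "s \<union> t \<subseteq> \<sigma>"
    using s t unfolding iseg_def by auto
  then have Min: "Min (s \<union> t) = m"
    using fin ms m by (intro Min_eqI) auto
  have "iseg s (s \<union> t)"
    using s(2) sub unfolding iseg_def by blast
  moreover have "iseg t (s \<union> t - {m})"
    using t(2) sub unfolding iseg_def by blast
  ultimately have "s \<triangleleft> t"
    using fin Min by (simp add: tri_iff_iseg)
  then have "s \<union> t \<in> square B"
    using s t unfolding square_def by blast
  \<comment> \<open>An element of \<open>\<sigma>\<close> below some element of \<open>t\<close> is
    either \<open>m\<close>, which is in \<open>s\<close>, or an element of
    \<open>\<sigma> - {m}\<close> and then in \<open>t\<close>.\<close>
  moreover have "iseg (s \<union> t) \<sigma>"
    using s(2) t(2) ms unfolding iseg_def by blast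
  ultimately show thesis
    using that by blast
qed

lemma square_antichain:
  assumes B: "barrier B" and uv: "u \<in> square B" "v \<in> square B" "u \<subseteq> v"
  shows "u = v"
proof -
  have fin: "finite u" "finite v" and ne: "u \<noteq> {}" "v \<noteq> {}"
    using assms square_finite square_nonempty by auto
  have Min: "Min u \<in> u" "Min v \<in> v" "Min v \<le> Min u"
    using fin ne uv(3) by (auto intro: Min_antimono)
  have "u - {Min u} \<subseteq> v - {Min v}"
  proof
    fix x
    assume x: "x \<in> u - {Min u}"
    then have "Min v < x"
      using Min(3) Min_le[OF fin(1), of x] by auto
    then show "x \<in> v - {Min v}"
      using x uv(3) by auto
  qed
  then have eq: "u - {Min u} = v - {Min v}"
    using barrier_antichain[OF B] square_minus_Min[OF B] uv by blast
  \<comment> \<open>\<open>Min u\<close> lies in \<open>v\<close> but not in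
    \<open>u - {Min u}\<close>, which is \<open>v - {Min v}\<close>.\<close>
  then have "Min u = Min v"
    using Min(1) uv(3) by blast
  with eq show ?thesis
    using Min(1,2) by (metis insert_Diff)
qed

lemma barrier_square:
  assumes B: "barrier B"
  shows "barrier (square B)"
proof -
  have sub: "\<Union>(square B) \<subseteq> \<Union>B"
    unfolding square_def by blast
  \<comment> \<open>A prefix of the part of \<open>\<Union>B\<close> above \<open>k\<close> is a
    nonempty member of the square with all its elements above \<open>k\<close>.\<close>
  have "\<exists>x>k. x \<in> \<Union>(square B)" for k
  proof -
    have "infinite (\<Union>B - {..k})"
      using B unfolding barrier_def by (meson Diff_infinite_finite finite_atMost)
    then obtain u where u: "u \<in> square B" "iseg u (\<Union>B - {..k})"
      using square_iseg[OF B] by (metis Diff_subset)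
    then obtain x where "x \<in> u"
      using square_nonempty[OF B] by blast
    then have "x > k" "x \<in> \<Union>(square B)"
      using u iseg_subset[OF u(2)] by auto
    then show ?thesis
      by blast
  qed
  then have "infinite (\<Union>(square B))"
    by (simp add: infinite_nat_iff_unbounded)
  moreover have "\<exists>u\<in>square B. prefix_inf u \<sigma>" if \<sigma>: "infinite \<sigma>" "\<sigma> \<subseteq> \<Union>(square B)" for \<sigma>
  proof -
    obtain u where u: "u \<in> square B" "iseg u \<sigma>"
      using square_iseg[OF B \<sigma>(1) subset_trans[OF \<sigma>(2) sub]] .
    then show ?thesis
      using prefix_inf_iff_iseg[OF square_finite[OF B u(1)] \<sigma>(1)] by blast
  qed
  ultimately show ?thesis
    using square_finite[OF B] square_antichain[OF B] unfolding barrier_def by blast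
qed

lemma square_lift:
  fixes F :: "nat set \<Rightarrow> nat set \<Rightarrow> 'c"
  assumes "barrier B"
  obtains G where "\<And>s t. s \<in> B \<Longrightarrow> t \<in> B \<Longrightarrow> s \<triangleleft> t \<Longrightarrow> G (s \<union> t) = F s t"
proof -
  define P where "P u p \<longleftrightarrow> fst p \<in> B \<and> snd p \<in> B \<and> fst p \<triangleleft> snd p \<and> u = fst p \<union> snd p" for u p
  have "(SOME p. P (s \<union> t) p) = (s, t)" if "s \<in> B" "t \<in> B" "s \<triangleleft> t" for s t
  proof (rule some_equality)
    show "P (s \<union> t) (s, t)"
      using that by (simp add: P_def)
    show "p = (s, t)" if "P (s \<union> t) p" for p
      using that \<open>s \<in> B\<close> \<open>t \<in> B\<close> \<open>s \<triangleleft> t\<close>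
        barrier_union_unique[OF assms, of "fst p" "snd p" s t]
      unfolding P_def by (simp add: prod_eq_iff)
  qed
  then show thesis
    \<comment> \<open>The witness decodes \<open>u\<close> into its unique pair; off the square the
      chosen pair is arbitrary.\<close>
    by (intro that[of "\<lambda>u. case_prod F (SOME p. P u p)"]) simp
qed

section \<open>Well-foundedness of the lexicographic order\<close>

definition lex_strict :: "nat set set \<Rightarrow> nat set rel" where
  "lex_strict B = {(s, t). s \<in> B \<and> t \<in> B \<and>
     (sorted_list_of_set s, sorted_list_of_set t) \<in> lexord less_than}"

lemma lexord_less_than_irrefl: "(xs, xs) \<notin> lexord less_than"
  by (simp add: lexord_irreflexive)

text \<open>Well-orders are defined by well-foundedness of the relation without \<open>Id\<close>,
  so \<open>lex_strict\<close> is the form in which that condition is handled.\<close>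

lemma lex_on_minus_Id: "lex_on B - Id = lex_strict B"
  unfolding lex_on_def lex_strict_def using lexord_less_than_irrefl by auto

lemma Field_lex_on: "Field (lex_on B) = B"
  unfolding lex_on_def Field_def by auto

lemma Well_order_lex_on:
  assumes fin: "\<And>s. s \<in> B \<Longrightarrow> finite s" and "wf (lex_strict B)"
  shows "Well_order (lex_on B)"
proof -
  have tr: "trans (lexord less_than)"
    by (simp add: lexord_transI)
  have "refl_on B (lex_on B)"
    unfolding refl_on_def lex_on_def by auto
  moreover have "lex_on B \<subseteq> B \<times> B"
    unfolding lex_on_def by auto
  moreover have "trans (lex_on B)"
    using tr unfolding trans_def lex_on_def by blast
  moreover have "antisym (lex_on B)"
    using tr lexord_less_than_irrefl unfolding antisym_def trans_def lex_on_def by blast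
  moreover have "total_on B (lex_on B)"
    unfolding total_on_def
  proof (intro ballI impI)
    fix s t
    assume st: "s \<in> B" "t \<in> B" "s \<noteq> t"
    \<comment> \<open>Finiteness matters here: \<open>sorted_list_of_set\<close> sends every
      infinite set to the empty list.\<close>
    then have "sorted_list_of_set s \<noteq> sorted_list_of_set t"
      using fin by (metis set_sorted_list_of_set)
    then have "(sorted_list_of_set s, sorted_list_of_set t) \<in> lexord less_than \<or>
        (sorted_list_of_set t, sorted_list_of_set s) \<in> lexord less_than"
      using lexord_linear[of less_than] by (metis less_than_iff linorder_neqE_nat)
    then show "(s, t) \<in> lex_on B \<or> (t, s) \<in> lex_on B"
      using st unfolding lex_on_def by blast
  qed
  ultimately show ?thesis
    using assms(2) unfolding well_order_on_def linear_order_on_def partial_order_on_def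
      preorder_on_def Field_lex_on lex_on_minus_Id by blast
qed

text \<open>Members of the square compare first by minimum and then by the remainder, which lies in
  \<open>B\<close>. Well-foundedness is thus inherited from \<open>B\<close> rather than derived for
  arbitrary barriers.\<close>

lemma wf_lex_strict_square:
  assumes B: "barrier B" and "wf (lex_strict B)"
  shows "wf (lex_strict (square B))"
proof -
  have "lex_strict (square B) \<subseteq> inv_image (less_than <*lex*> lex_strict B) (\<lambda>u. (Min u, u - {Min u}))"
  proof clarify
    fix u v
    assume uv: "(u, v) \<in> lex_strict (square B)"
    then have sq: "u \<in> square B" "v \<in> square B"
      unfolding lex_strict_def by auto
    have "sorted_list_of_set w = Min w # sorted_list_of_set (w - {Min w})" if "w \<in> square B" for w
      using square_finite[OF B that] square_nonempty[OF B that]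
      by (rule sorted_list_of_set_nonempty)
    with uv sq show "(u, v) \<in> inv_image (less_than <*lex*> lex_strict B) (\<lambda>u. (Min u, u - {Min u}))"
      using square_minus_Min[OF B] by (auto simp: lex_strict_def)
  qed
  moreover have "wf (inv_image (less_than <*lex*> lex_strict B) (\<lambda>u. (Min u, u - {Min u})))"
    using assms(2) by (intro wf_inv_image wf_lex_prod wf_less_than)
  ultimately show ?thesis
    by (rule wf_subset[rotated])
qed

text \<open>The ordinal is taken to be the order type of \<open>B\<close> itself, copied to the
  naturals by \<open>set_encode\<close>, which is injective on finite sets.\<close>

lemma bqo_good:
  assumes "bqo Q r" "barrier B" "wf (lex_strict B)" "f \<in> B \<rightarrow> Q"
  shows "good r B f"
proof -
  let ?\<alpha> = "dir_image (lex_on B) set_encode"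
  have wo: "Well_order (lex_on B)"
    using assms Well_order_lex_on barrier_finite by blast
  have inj: "inj_on set_encode (Field (lex_on B))"
    using inj_on_set_encode barrier_finite[OF assms(2)]
    unfolding Field_lex_on by (auto intro: inj_on_subset)
  have "Well_order ?\<alpha>"
    using wo inj by (rule Well_order_dir_image)
  moreover have "(lex_on B, ?\<alpha>) \<in> ordLeq"
    using dir_image_ordIso[OF wo inj] ordIso_iff_ordLeq by blast
  ultimately show ?thesis
    using assms unfolding bqo_def alpha_wqo_def by blast
qed

section \<open>Transfer of bad maps along a deformation\<close>

lemma bess_imp_good_image:
  assumes mono: "mono_on \<M> D" and "bess \<M>"
    and B: "barrier B" "wf (lex_strict B)" and f: "f \<in> B \<rightarrow> \<Union>(D ` \<M>)"
  shows "good (qo (D ` \<M>)) B f"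
proof (rule ccontr)
  assume bad: "\<not> good (qo (D ` \<M>)) B f"
  have "\<exists>M\<in>\<M>. f s \<in> D M \<and> f t \<notin> D M" if "s \<in> B" "t \<in> B" "s \<triangleleft> t" for s t
  proof -
    have "(f s, f t) \<notin> qo (D ` \<M>)"
      using bad that unfolding good_def by blast
    \<comment> \<open>A pair can also fail to be in \<open>qo\<close> by leaving the union;
      excluding this yields a separating member.\<close>
    moreover have "f s \<in> \<Union>(D ` \<M>)" "f t \<in> \<Union>(D ` \<M>)"
      using f that by (auto dest: funcset_mem)
    ultimately show ?thesis
      unfolding qo_def by simp blast
  qed
  then obtain N where N: "\<And>s t. s \<in> B \<Longrightarrow> t \<in> B \<Longrightarrow> s \<triangleleft> t \<Longrightarrow>
      N s t \<in> \<M> \<and> f s \<in> D (N s t) \<and> f t \<notin> D (N s t)"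
    by metis
  \<comment> \<open>\<open>h\<close> is \<open>N\<close> read as a function on the square, so that
    successive members \<open>u\<close>, \<open>v\<close> receive \<open>N s t\<close> and
    \<open>N t r\<close> with a common \<open>t\<close>.\<close>
  obtain h where h: "\<And>s t. s \<in> B \<Longrightarrow> t \<in> B \<Longrightarrow> s \<triangleleft> t \<Longrightarrow> h (s \<union> t) = N s t"
    using square_lift[OF B(1)] by metis
  have h_mem: "h u \<in> \<M>" if "u \<in> square B" for u
    using that by (metis N h squareE)
  have h_bad: "\<exists>x. x \<in> h v \<and> x \<notin> h u" if uv: "u \<in> square B" "v \<in> square B" "u \<triangleleft> v" for u v
  proof -
    obtain s t r where str: "s \<in> B" "t \<in> B" "r \<in> B" "s \<triangleleft> t" "t \<triangleleft> r" "u = s \<union> t" "v = t \<union> r"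
      using square_tri[OF B(1) uv] by metis
    then have "\<not> D (h v) \<subseteq> D (h u)"
      using N h by (metis subsetD)
    then show ?thesis
      using mono h_mem uv by (meson mono_onD subsetI)
  qed
  then obtain k where k: "\<And>u v. u \<in> square B \<Longrightarrow> v \<in> square B \<Longrightarrow> u \<triangleleft> v \<Longrightarrow>
      k u v \<in> h v \<and> k u v \<notin> h u"
    by metis
  have sq: "barrier (square B)" "wf (lex_strict (square B))"
    using B by (simp_all add: barrier_square wf_lex_strict_square)
  obtain g where g: "\<And>u v. u \<in> square B \<Longrightarrow> v \<in> square B \<Longrightarrow> u \<triangleleft> v \<Longrightarrow> g (u \<union> v) = k u v"
    using square_lift[OF sq(1)] by metis
  have "g \<in> square (square B) \<rightarrow> \<Union>\<M>"
  proof
    fix w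
    assume "w \<in> square (square B)"
    then obtain u v where uv: "u \<in> square B" "v \<in> square B" "u \<triangleleft> v" "w = u \<union> v"
      by (rule squareE)
    then have "g w \<in> h v"
      using g k by simp
    then show "g w \<in> \<Union>\<M>"
      using h_mem[OF uv(2)] by blast
  qed
  then have "good (qo \<M>) (square (square B)) g"
    using assms(2) sq unfolding bess_def
    by (intro bqo_good) (simp_all add: barrier_square wf_lex_strict_square)
  then obtain w x where wx: "w \<in> square (square B)" "x \<in> square (square B)" "w \<triangleleft> x"
      and le: "(g w, g x) \<in> qo \<M>"
    unfolding good_def by blast
  obtain u v y where uvy: "u \<in> square B" "v \<in> square B" "y \<in> square B" "u \<triangleleft> v" "v \<triangleleft> y"
      "w = u \<union> v" "x = v \<union> y"
    using square_tri[OF sq(1) wx] by metis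
  \<comment> \<open>Here \<open>g w = k u v\<close> and \<open>g x = k v y\<close>, so the shared
    component \<open>v\<close> supplies the set separating them.\<close>
  then have "g w \<in> h v" "g x \<notin> h v"
    using g k by metis+
  with le h_mem[OF uvy(2)] show False
    unfolding qo_def by blast
qed

theorem theorem2:
  fixes S :: "'a set" and T :: "'b set"
    and \<M> :: "'a set set" and \<L> :: "'b set set"
    and D :: "'a set \<Rightarrow> 'b set"
  assumes "set_system S \<M>"
    and "set_system T \<L>"
    and "deformation \<M> \<L> D"
    and "bess \<M>"
  shows "bess (D ` \<M>)"
  unfolding bess_def bqo_def alpha_wqo_def
proof (intro allI impI conjI ballI)
  show "preorder_on (\<Union>(D ` \<M>)) (qo (D ` \<M>))"
    by (rule preorder_on_qo)
next
  fix \<alpha> :: "nat rel" and B and f :: "nat set \<Rightarrow> 'b"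
  assume B: "barrier B \<and> (lex_on B, \<alpha>) \<in> ordLeq" and f: "f \<in> B \<rightarrow> \<Union>(D ` \<M>)"
  \<comment> \<open>\<open>ordLeq\<close> relates only well-orders, so the bound on the order type
    already contains well-foundedness.\<close>
  have "wf (lex_strict B)"
    using B by (auto simp: ordLeq_def well_order_on_def lex_on_minus_Id)
  then show "good (qo (D ` \<M>)) B f"
    using assms B f by (intro bess_imp_good_image) (auto simp: deformation_def)
qed

end
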